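(* Let $\delta_1,\delta_1'$ be proximities on a set $X$ and let $(Y,\delta')$ be a proximity space. Let $f_1,f_2:(X,\delta_1)\to(Y,\delta')$ and $g_1,g_2:(X,\delta_1')\to(Y,\delta')$ be pc-maps such that $f_1\simeq_{\delta_1,\delta'}f_2$ and $g_1\simeq_{\delta_1',\delta'}g_2$. If $\delta_1'>\delta_1$, then $$\mathrm{D}_{\delta_1',\delta'}(f_2,g_2)\le \mathrm{D}_{\delta_1,\delta'}(f_1,g_1).$$
   Context: A proximity on a set $X$ is a binary relation $\delta$ on subsets of $X$ such that for all $E,F,G\subset X$: $E\delta F\Rightarrow F\delta E$; $(E\cup F)\delta G\Leftrightarrow (E\delta G$ or $F\delta G)$; $E\delta F\Rightarrow E\ne\emptyset$ and $F\neq\emptyset$; $E\cap F\ne\emptyset\Rightarrow E\delta F$; if $E\delta F$ fails, there is $G\subset X$ such that $E\delta G$ fails and $(X\setminus G)\delta F$ fails. $E\delta F$ is read "$E$ is near $F$". $\delta'>\delta$ ($\delta'$ is finer than $\delta$) on the same set means that $E\delta'F$ implies $E\delta F$. Subsets carry the subspace proximity (restriction). A product $X\times X'$ carries the product proximity (Leader): $A$ is near $B$ iff for all finite covers $A=\bigcup_i A_i$, $B=\bigcup_j B_j$ there are $i,j$ such that both projections of $A_i$ are near the corresponding projections of $B_j$; for rectangles, $E_1\times E_2$ is near $F_1\times F_2$ iff $E_1$ is near $F_1$ and $E_2$ is near $F_2$. A map $f:(X,\delta)\to(X',\delta')$ is a pc-map if $E\delta F$ implies $f(E)\delta' f(F)$.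 $I=[0,1]$ carries its usual metric proximity. Maps $f,g:X\to Y$ are proximally homotopic with respect to proximities $\delta$ on $X$ and $\delta'$ on $Y$, written $f\simeq_{\delta,\delta'}g$, if there is a pc-map $G:X\times I\to Y$ with $G(x,0)=f(x)$ and $G(x,1)=g(x)$. The proximal homotopic distance $\mathrm{D}_{\delta,\delta'}(f,g)$ is the least integer $m>0$ such that $X$ has a cover $\{V_1,\dots,V_m\}$ by (arbitrary) subsets with $f|_{V_j}\simeq_{\delta,\delta'}g|_{V_j}$ for all $j$ (with the subspace proximity on $V_j$), and $\infty$ if there is no such cover. This definition is used with the same wording for maps $f,g:X\to Y$ that are not assumed to be pc-maps for the proximities in the subscript. *)

theory Defs
  imports "HOL-Analysis.Analysis" "HOL-Library.Extended_Nat"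
begin

text \<open>
  A proximity on a carrier set \<open>X\<close> is a relation on sets that is only ever consulted on
  subsets of \<open>X\<close>; its values on other sets are irrelevant.
\<close>

definition proximity_on :: "'a set \<Rightarrow> ('a set \<Rightarrow> 'a set \<Rightarrow> bool) \<Rightarrow> bool" where
  "proximity_on X \<delta> \<longleftrightarrow>
     (\<forall>E F. E \<subseteq> X \<longrightarrow> F \<subseteq> X \<longrightarrow> \<delta> E F \<longrightarrow> \<delta> F E) \<and>
     (\<forall>E F G. E \<subseteq> X \<longrightarrow> F \<subseteq> X \<longrightarrow> G \<subseteq> X \<longrightarrow> (\<delta> (E \<union> F) G \<longleftrightarrow> \<delta> E G \<or> \<delta> F G)) \<and>
     (\<forall>E F. E \<subseteq> X \<longrightarrow> F \<subseteq> X \<longrightarrow> \<delta> E F \<longrightarrow> E \<noteq> {} \<and> F \<noteq> {}) \<and>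
     (\<forall>E F. E \<subseteq> X \<longrightarrow> F \<subseteq> X \<longrightarrow> E \<inter> F \<noteq> {} \<longrightarrow> \<delta> E F) \<and>
     (\<forall>E F. E \<subseteq> X \<longrightarrow> F \<subseteq> X \<longrightarrow> \<not> \<delta> E F \<longrightarrow>
        (\<exists>G. G \<subseteq> X \<and> \<not> \<delta> E G \<and> \<not> \<delta> (X - G) F))"

definition finer_proximity ::
  "'a set \<Rightarrow> ('a set \<Rightarrow> 'a set \<Rightarrow> bool) \<Rightarrow> ('a set \<Rightarrow> 'a set \<Rightarrow> bool) \<Rightarrow> bool" where
  "finer_proximity X \<delta>' \<delta> \<longleftrightarrow> (\<forall>E F. E \<subseteq> X \<longrightarrow> F \<subseteq> X \<longrightarrow> \<delta>' E F \<longrightarrow> \<delta> E F)"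

definition subspace_proximity ::
  "'a set \<Rightarrow> ('a set \<Rightarrow> 'a set \<Rightarrow> bool) \<Rightarrow> 'a set \<Rightarrow> 'a set \<Rightarrow> bool" where
  "subspace_proximity V \<delta> E F \<longleftrightarrow> E \<subseteq> V \<and> F \<subseteq> V \<and> \<delta> E F"

text \<open>Leader's product proximity.\<close>

definition product_proximity ::
  "('a set \<Rightarrow> 'a set \<Rightarrow> bool) \<Rightarrow> ('b set \<Rightarrow> 'b set \<Rightarrow> bool) \<Rightarrow> ('a \<times> 'b) set \<Rightarrow> ('a \<times> 'b) set \<Rightarrow> bool" where
  "product_proximity \<delta> \<delta>' A B \<longleftrightarrow>
     (\<forall>\<A> \<B>. finite \<A> \<longrightarrow> finite \<B> \<longrightarrow> A = \<Union>\<A> \<longrightarrow> B = \<Union>\<B> \<longrightarrow>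
        (\<exists>P\<in>\<A>. \<exists>Q\<in>\<B>. \<delta> (fst ` P) (fst ` Q) \<and> \<delta>' (snd ` P) (snd ` Q)))"

text \<open>Nonemptiness is needed because \<open>setdist\<close> is 0 when an argument is empty.\<close>

definition metric_proximity :: "'a::metric_space set \<Rightarrow> 'a set \<Rightarrow> bool" where
  "metric_proximity E F \<longleftrightarrow> E \<noteq> {} \<and> F \<noteq> {} \<and> setdist E F = 0"

definition unit_interval_proximity :: "real set \<Rightarrow> real set \<Rightarrow> bool" where
  "unit_interval_proximity = subspace_proximity {0..1} metric_proximity"

definition pc_map ::
  "'a set \<Rightarrow> ('a set \<Rightarrow> 'a set \<Rightarrow> bool) \<Rightarrow> 'b set \<Rightarrow> ('b set \<Rightarrow> 'b set \<Rightarrow> bool) \<Rightarrow> ('a \<Rightarrow> 'b) \<Rightarrow> bool" where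
  "pc_map X \<delta> Y \<delta>' f \<longleftrightarrow>
     f ` X \<subseteq> Y \<and> (\<forall>E F. E \<subseteq> X \<longrightarrow> F \<subseteq> X \<longrightarrow> \<delta> E F \<longrightarrow> \<delta>' (f ` E) (f ` F))"

definition proximally_homotopic ::
  "'a set \<Rightarrow> ('a set \<Rightarrow> 'a set \<Rightarrow> bool) \<Rightarrow> 'b set \<Rightarrow> ('b set \<Rightarrow> 'b set \<Rightarrow> bool) \<Rightarrow>
     ('a \<Rightarrow> 'b) \<Rightarrow> ('a \<Rightarrow> 'b) \<Rightarrow> bool" where
  "proximally_homotopic X \<delta> Y \<delta>' f g \<longleftrightarrow>
     (\<exists>G. pc_map (X \<times> {0..1}) (product_proximity \<delta> unit_interval_proximity) Y \<delta>' G \<and>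
          (\<forall>x\<in>X. G (x, 0) = f x \<and> G (x, 1) = g x))"

text \<open>
  The infimum in \<open>enat\<close> is the least element of a nonempty set, and \<open>\<infinity>\<close> for the empty set.
  The maps need not be pc-maps for \<open>\<delta>\<close> and \<open>\<delta>'\<close>.
\<close>

definition proximal_homotopic_distance ::
  "'a set \<Rightarrow> ('a set \<Rightarrow> 'a set \<Rightarrow> bool) \<Rightarrow> 'b set \<Rightarrow> ('b set \<Rightarrow> 'b set \<Rightarrow> bool) \<Rightarrow>
     ('a \<Rightarrow> 'b) \<Rightarrow> ('a \<Rightarrow> 'b) \<Rightarrow> enat" where
  "proximal_homotopic_distance X \<delta> Y \<delta>' f g =
     Inf {enat m | m. m > 0 \<and>
       (\<exists>V :: nat \<Rightarrow> 'a set. (\<Union>j\<in>{1..m}. V j) = X \<and>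
          (\<forall>j\<in>{1..m}. proximally_homotopic (V j) (subspace_proximity (V j) \<delta>) Y \<delta>' f g))}"

end

theory Submission imports Defs begin

text \<open>
  The distance is monotone because every cover that is admissible for \<open>f1\<close>, \<open>g1\<close> and the coarser
  proximity is admissible for \<open>f2\<close>, \<open>g2\<close> and the finer one. On a member \<open>V\<close> of such a cover,
  \<open>f2 \<simeq> f1 \<simeq> g1 \<simeq> g2\<close>: a proximal homotopy restricts to subsets and remains one when the
  proximity of the source is refined (\<open>proximally_homotopic_weaken\<close>), so all three homotopies
  are available for the finer subspace proximity on \<open>V\<close>. It remains to see that proximal homotopy
  is symmetric and transitive.

  Transitivity rests on gluing pc-maps along \<open>V \<times> {c}\<close> (\<open>pc_map_glue\<close>). The only case that is
  not immediate is that of near sets \<open>A \<subseteq> V \<times> [0,c]\<close> and \<open>B \<subseteq> V \<times> [c,1]\<close>. Write \<open>p(x,t) = (x,c)\<close>.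
  Nearness of \<open>A\<close> and \<open>B\<close> forces both to approach the level \<open>c\<close>, so that \<open>A\<close> is near \<open>p(B)\<close>, and
  also \<open>p(B)\<close> is near \<open>B\<close>; the same holds for every part of \<open>B\<close> that is still near \<open>A\<close>. If \<open>G(A)\<close>
  and \<open>G(B)\<close> were far, the last axiom of a proximity would give a set \<open>C\<close> with \<open>G(A)\<close> far from \<open>C\<close>
  and \<open>Y - C\<close> far from \<open>G(B)\<close>. Splitting \<open>B\<close> according to whether \<open>G(p(b)) \<in> C\<close>, one of the two
  parts is near \<open>A\<close>, and either case contradicts one half of \<open>G\<close> being a pc-map.
\<close>

section \<open>Elementary properties of proximities\<close>

text \<open>
  Symmetry and monotonicity on subsets of \<open>X\<close>. The product proximity inherits symmetry and
  additivity from factors with these two properties alone, so the separation axiom need not be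
  verified for the unit interval.
\<close>

definition sym_mono_on :: "'a set \<Rightarrow> ('a set \<Rightarrow> 'a set \<Rightarrow> bool) \<Rightarrow> bool" where
  "sym_mono_on X \<delta> \<longleftrightarrow>
     (\<forall>E F. E \<subseteq> X \<longrightarrow> F \<subseteq> X \<longrightarrow> \<delta> E F \<longrightarrow> \<delta> F E) \<and>
     (\<forall>E F F'. E \<subseteq> X \<longrightarrow> F' \<subseteq> X \<longrightarrow> F \<subseteq> F' \<longrightarrow> \<delta> E F \<longrightarrow> \<delta> E F')"

lemma sym_mono_on_sym:
  assumes "sym_mono_on X \<delta>" "\<delta> E F" "E \<subseteq> X" "F \<subseteq> X"
  shows "\<delta> F E"
  using assms unfolding sym_mono_on_def by blast

lemma sym_mono_on_mono:
  assumes "sym_mono_on X \<delta>" "\<delta> E F" "E \<subseteq> E'" "F \<subseteq> F'" "E' \<subseteq> X" "F' \<subseteq> X"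
  shows "\<delta> E' F'"
proof -
  have "\<delta> E F'"
    using assms unfolding sym_mono_on_def by (meson subset_trans)
  then have "\<delta> F' E"
    using assms sym_mono_on_sym by (meson subset_trans)
  then have "\<delta> F' E'"
    using assms unfolding sym_mono_on_def by blast
  then show ?thesis
    using assms sym_mono_on_sym by blast
qed

lemma proximity_on_imp_sym_mono_on:
  assumes "proximity_on X \<delta>"
  shows "sym_mono_on X \<delta>"
proof -
  have sym: "\<delta> F E" if "E \<subseteq> X" "F \<subseteq> X" "\<delta> E F" for E F
    using assms that by (simp add: proximity_on_def)
  have un: "\<delta> (E \<union> F) H \<longleftrightarrow> \<delta> E H \<or> \<delta> F H" if "E \<subseteq> X" "F \<subseteq> X" "H \<subseteq> X" for E F H
    using assms that by (simp add: proximity_on_def)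
  have "\<delta> E F'" if "E \<subseteq> X" "F' \<subseteq> X" "F \<subseteq> F'" "\<delta> E F" for E F F'
  proof -
    have F: "F \<subseteq> X"
      using that(3,2) by (rule subset_trans)
    have "\<delta> (F \<union> F') E"
      using un[OF F that(2,1)] sym[OF that(1) F that(4)] by blast
    then have "\<delta> F' E"
      using that(3) by (simp add: Un_absorb1)
    then show ?thesis
      by (rule sym[OF that(2,1)])
  qed
  with sym show ?thesis
    unfolding sym_mono_on_def by simp
qed

lemma proximity_on_separation:
  assumes "proximity_on X \<delta>" "E \<subseteq> X" "F \<subseteq> X" "\<not> \<delta> E F"
  obtains C where "C \<subseteq> X" "\<not> \<delta> E C" "\<not> \<delta> (X - C) F"
proof -
  have "\<exists>C. C \<subseteq> X \<and> \<not> \<delta> E C \<and> \<not> \<delta> (X - C) F"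
    using assms unfolding proximity_on_def by blast
  with that show thesis by blast
qed

lemma proximity_on_Int_near:
  assumes "proximity_on X \<delta>" "E \<subseteq> X" "F \<subseteq> X" "E \<inter> F \<noteq> {}"
  shows "\<delta> E F"
  using assms by (simp add: proximity_on_def)

lemma proximity_on_subspace:
  assumes X: "proximity_on X \<delta>" and V: "V \<subseteq> X"
  shows "proximity_on V (subspace_proximity V \<delta>)"
proof -
  note sm = proximity_on_imp_sym_mono_on[OF X]
  have sub: "E \<subseteq> X" if "E \<subseteq> V" for E
    using that V by (rule subset_trans)
  have sep: "\<exists>H. H \<subseteq> V \<and> \<not> \<delta> E H \<and> \<not> \<delta> (V - H) F"
    if EF: "E \<subseteq> V" "F \<subseteq> V" "\<not> \<delta> E F" for E F
  proof -
    obtain C where C: "C \<subseteq> X" "\<not> \<delta> E C" "\<not> \<delta> (X - C) F"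
      using proximity_on_separation[OF X sub[OF EF(1)] sub[OF EF(2)] EF(3)] .
    have "\<not> \<delta> E (C \<inter> V)"
      using sym_mono_on_mono[OF sm _ subset_refl Int_lower1 sub[OF EF(1)] C(1)] C(2) by blast
    moreover have "V - C \<inter> V \<subseteq> X - C" "X - C \<subseteq> X"
      using V by auto
    then have "\<not> \<delta> (V - C \<inter> V) F"
      using sym_mono_on_mono[OF sm _ _ subset_refl _ sub[OF EF(2)]] C(3) by blast
    ultimately show ?thesis
      by (intro exI[of _ "C \<inter> V"] conjI) auto
  qed
  show ?thesis
    unfolding proximity_on_def subspace_proximity_def
  proof (intro conjI allI impI)
    fix E F
    assume EF: "E \<subseteq> V" "F \<subseteq> V"
    note EF' = sub[OF EF(1)] sub[OF EF(2)]
    show "\<exists>H\<subseteq>V. \<not> (E \<subseteq> V \<and> H \<subseteq> V \<and> \<delta> E H) \<and> \<not> (V - H \<subseteq> V \<and> F \<subseteq> V \<and> \<delta> (V - H) F)"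
      if "\<not> (E \<subseteq> V \<and> F \<subseteq> V \<and> \<delta> E F)"
      using sep[OF EF] that EF by blast
    show "(E \<union> F \<subseteq> V \<and> H \<subseteq> V \<and> \<delta> (E \<union> F) H) \<longleftrightarrow>
        (E \<subseteq> V \<and> H \<subseteq> V \<and> \<delta> E H) \<or> (F \<subseteq> V \<and> H \<subseteq> V \<and> \<delta> F H)" if H: "H \<subseteq> V" for H
    proof -
      have "\<delta> (E \<union> F) H \<longleftrightarrow> \<delta> E H \<or> \<delta> F H"
        using X EF' sub[OF H] by (simp add: proximity_on_def)
      with EF H show ?thesis by blast
    qed
    show "\<delta> F E" if "E \<subseteq> V \<and> F \<subseteq> V \<and> \<delta> E F"
      using that sym_mono_on_sym[OF sm _ EF'] by blast
    show "E \<noteq> {}" "F \<noteq> {}" if "E \<subseteq> V \<and> F \<subseteq> V \<and> \<delta> E F"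
      using X EF' that by (auto simp: proximity_on_def)
    show "\<delta> E F" if "E \<inter> F \<noteq> {}"
      using proximity_on_Int_near[OF X EF' that] .
  qed
qed

lemma unit_interval_proximity_iff:
  "unit_interval_proximity S T \<longleftrightarrow>
     S \<subseteq> {0..1} \<and> T \<subseteq> {0..1} \<and> (\<forall>e>0. \<exists>s\<in>S. \<exists>t\<in>T. \<bar>s - t\<bar> < e)"
proof -
  have "metric_proximity S T \<longleftrightarrow> (\<forall>e>0. \<exists>s\<in>S. \<exists>t\<in>T. \<bar>s - t\<bar> < e)" (is "?L \<longleftrightarrow> ?R")
  proof
    assume L: ?L
    show ?R
    proof (intro allI impI)
      fix e :: real
      assume "e > 0"
      then show "\<exists>s\<in>S. \<exists>t\<in>T. \<bar>s - t\<bar> < e"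
        using L setdist_ltE[of S T e] by (metis dist_real_def metric_proximity_def)
    qed
  next
    assume R: ?R
    then have "S \<noteq> {}" "T \<noteq> {}"
      using zero_less_one by blast+
    moreover have "\<not> setdist S T > 0"
      using R setdist_le_dist[of _ S _ T] by (force simp: dist_real_def)
    ultimately show ?L
      using setdist_pos_le[of S T] by (simp add: metric_proximity_def)
  qed
  then show ?thesis
    by (auto simp: unit_interval_proximity_def subspace_proximity_def)
qed

lemma sym_mono_on_unit_interval: "sym_mono_on {0..1} unit_interval_proximity"
proof -
  have "unit_interval_proximity F E" if "unit_interval_proximity E F" for E F
    using that unfolding unit_interval_proximity_iff by (metis abs_minus_commute)
  moreover have "unit_interval_proximity E F'"
    if "F' \<subseteq> {0..1}" "F \<subseteq> F'" "unit_interval_proximity E F" for E F F'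
    using that unfolding unit_interval_proximity_iff by (meson subset_iff)
  ultimately show ?thesis
    unfolding sym_mono_on_def by blast
qed

lemma unit_interval_proximity_Lipschitz_image:
  assumes "unit_interval_proximity S T" and "\<phi> ` S \<subseteq> {0..1}" "\<phi> ` T \<subseteq> {0..1}"
    and "L > 0" and L: "\<And>s t. \<bar>\<phi> s - \<phi> t\<bar> \<le> L * \<bar>s - t\<bar>"
  shows "unit_interval_proximity (\<phi> ` S) (\<phi> ` T)"
proof -
  have "\<exists>s\<in>S. \<exists>t\<in>T. \<bar>\<phi> s - \<phi> t\<bar> < e" if "e > 0" for e
  proof -
    have "e / L > 0"
      using that \<open>L > 0\<close> by simp
    then obtain s t where st: "s \<in> S" "t \<in> T" "\<bar>s - t\<bar> < e / L"
      using assms(1) unfolding unit_interval_proximity_iff by blast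
    then have "L * \<bar>s - t\<bar> < e"
      using \<open>L > 0\<close> by (simp add: field_simps)
    with L[of s t] st(1,2) show ?thesis
      by (meson le_less_trans)
  qed
  with assms(2,3) show ?thesis
    unfolding unit_interval_proximity_iff by simp
qed

lemma unit_interval_proximity_singleton_between:
  assumes "unit_interval_proximity S T" and "S \<subseteq> {0..c}" "T \<subseteq> {c..1}"
  shows "unit_interval_proximity S {c}" "unit_interval_proximity {c} T"
proof -
  have ne: "S \<noteq> {}" "T \<noteq> {}"
    using assms(1) zero_less_one unfolding unit_interval_proximity_iff by blast+
  have c: "c \<in> {0..1}"
    using ne assms(2,3) by force
  have ex: "\<exists>s\<in>S. \<exists>t\<in>T. \<bar>s - c\<bar> < e \<and> \<bar>c - t\<bar> < e" if e: "e > 0" for e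
  proof -
    obtain s t where st: "s \<in> S" "t \<in> T" "\<bar>s - t\<bar> < e"
      using assms(1) e unfolding unit_interval_proximity_iff by blast
    have "s \<le> c" "c \<le> t"
      using st assms(2,3) by auto
    with st show ?thesis by (intro bexI[of _ s] bexI[of _ t]) auto
  qed
  have ST: "S \<subseteq> {0..1}" "T \<subseteq> {0..1}"
    using assms(1) unfolding unit_interval_proximity_iff by auto
  show "unit_interval_proximity S {c}" "unit_interval_proximity {c} T"
    unfolding unit_interval_proximity_iff using ex ST c by blast+
qed

section \<open>The product proximity\<close>

lemma fst_image_subset: "P \<subseteq> S \<times> T \<Longrightarrow> fst ` P \<subseteq> S"
  by auto

lemma snd_image_subset: "P \<subseteq> S \<times> T \<Longrightarrow> snd ` P \<subseteq> T"
  by auto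

lemma product_proximityE:
  assumes "product_proximity \<delta> \<alpha> A B" "finite \<A>" "finite \<B>" "A = \<Union>\<A>" "B = \<Union>\<B>"
  obtains P Q where "P \<in> \<A>" "Q \<in> \<B>" "\<delta> (fst ` P) (fst ` Q)" "\<alpha> (snd ` P) (snd ` Q)"
proof -
  have "\<exists>P\<in>\<A>. \<exists>Q\<in>\<B>. \<delta> (fst ` P) (fst ` Q) \<and> \<alpha> (snd ` P) (snd ` Q)"
    using assms(1)[unfolded product_proximity_def, rule_format, OF assms(2-5)] .
  with that show thesis by blast
qed

lemma not_product_proximityE:
  assumes "\<not> product_proximity \<delta> \<alpha> A B"
  obtains \<A> \<B> where "finite \<A>" "finite \<B>" "A = \<Union>\<A>" "B = \<Union>\<B>"
    "\<And>P Q. P \<in> \<A> \<Longrightarrow> Q \<in> \<B> \<Longrightarrow> \<not> (\<delta> (fst ` P) (fst ` Q) \<and> \<alpha> (snd ` P) (snd ` Q))"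
  using assms unfolding product_proximity_def by blast

text \<open>
  Finite covers of images are pulled back. The two sets may be moved by different maps.
\<close>

lemma product_proximity_image:
  assumes near: "product_proximity \<delta> \<alpha> A B"
    and step: "\<And>P Q. P \<subseteq> A \<Longrightarrow> Q \<subseteq> B \<Longrightarrow> \<delta> (fst ` P) (fst ` Q) \<Longrightarrow> \<alpha> (snd ` P) (snd ` Q) \<Longrightarrow>
      \<delta>2 (fst ` \<Phi> ` P) (fst ` \<Psi> ` Q) \<and> \<alpha>2 (snd ` \<Phi> ` P) (snd ` \<Psi> ` Q)"
  shows "product_proximity \<delta>2 \<alpha>2 (\<Phi> ` A) (\<Psi> ` B)"
  unfolding product_proximity_def
proof (intro allI impI)
  fix \<A> \<B>
  assume fin: "finite \<A>" "finite \<B>" and A: "\<Phi> ` A = \<Union>\<A>" and B: "\<Psi> ` B = \<Union>\<B>"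
  let ?a = "\<lambda>P. A \<inter> \<Phi> -` P" and ?b = "\<lambda>Q. B \<inter> \<Psi> -` Q"
  have "A \<subseteq> \<Phi> -` \<Union>\<A>" "B \<subseteq> \<Psi> -` \<Union>\<B>"
    unfolding A[symmetric] B[symmetric] by auto
  moreover have "\<Union>(?a ` \<A>) = A \<inter> \<Phi> -` \<Union>\<A>" "\<Union>(?b ` \<B>) = B \<inter> \<Psi> -` \<Union>\<B>"
    by auto
  ultimately have covers: "A = \<Union>(?a ` \<A>)" "B = \<Union>(?b ` \<B>)"
    by (simp_all add: Int_absorb2)
  obtain P' Q' where "P' \<in> ?a ` \<A>" "Q' \<in> ?b ` \<B>"
    "\<delta> (fst ` P') (fst ` Q')" "\<alpha> (snd ` P') (snd ` Q')"
    by (rule product_proximityE[OF near _ _ covers]) (use fin in auto)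
  then obtain P Q where PQ: "P \<in> \<A>" "Q \<in> \<B>"
    "\<delta> (fst ` ?a P) (fst ` ?b Q)" "\<alpha> (snd ` ?a P) (snd ` ?b Q)"
    by auto
  have "P \<subseteq> \<Phi> ` A" "Q \<subseteq> \<Psi> ` B"
    unfolding A B using PQ(1,2) by auto
  then have "\<Phi> ` ?a P = P" "\<Psi> ` ?b Q = Q"
    by blast+
  with step[OF Int_lower1 Int_lower1 PQ(3,4)] PQ(1,2)
  show "\<exists>P\<in>\<A>. \<exists>Q\<in>\<B>. \<delta>2 (fst ` P) (fst ` Q) \<and> \<alpha>2 (snd ` P) (snd ` Q)"
    by auto
qed

lemma product_proximity_sym:
  assumes "sym_mono_on X \<delta>" "sym_mono_on Z \<alpha>" "A \<subseteq> X \<times> Z" "B \<subseteq> X \<times> Z"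
    and near: "product_proximity \<delta> \<alpha> A B"
  shows "product_proximity \<delta> \<alpha> B A"
  unfolding product_proximity_def
proof (intro allI impI)
  fix \<B> \<A>
  assume fin: "finite \<B>" "finite \<A>" and B: "B = \<Union>\<B>" and A: "A = \<Union>\<A>"
  obtain P Q where PQ: "P \<in> \<A>" "Q \<in> \<B>" "\<delta> (fst ` P) (fst ` Q)" "\<alpha> (snd ` P) (snd ` Q)"
    using product_proximityE[OF near fin(2,1) A B] .
  have "P \<subseteq> X \<times> Z" "Q \<subseteq> X \<times> Z"
    using PQ A B assms(3,4) by blast+
  then have "\<delta> (fst ` Q) (fst ` P)" "\<alpha> (snd ` Q) (snd ` P)"
    using sym_mono_on_sym[OF assms(1) PQ(3)] sym_mono_on_sym[OF assms(2) PQ(4)]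
    by (simp_all add: fst_image_subset snd_image_subset)
  with PQ show "\<exists>Q\<in>\<B>. \<exists>P\<in>\<A>. \<delta> (fst ` Q) (fst ` P) \<and> \<alpha> (snd ` Q) (snd ` P)"
    by blast
qed

lemma product_proximity_Un_right:
  assumes sm: "sym_mono_on X \<delta>" "sym_mono_on Z \<alpha>"
    and sub: "A \<subseteq> X \<times> Z" "B1 \<subseteq> X \<times> Z" "B2 \<subseteq> X \<times> Z"
    and near: "product_proximity \<delta> \<alpha> A (B1 \<union> B2)"
  shows "product_proximity \<delta> \<alpha> A B1 \<or> product_proximity \<delta> \<alpha> A B2"
proof (rule ccontr)
  assume "\<not> ?thesis"
  then have far: "\<not> product_proximity \<delta> \<alpha> A B1" "\<not> product_proximity \<delta> \<alpha> A B2"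
    by auto
  obtain \<A>1 \<B>1 where 1: "finite \<A>1" "finite \<B>1" "A = \<Union>\<A>1" "B1 = \<Union>\<B>1"
      "\<And>P Q. P \<in> \<A>1 \<Longrightarrow> Q \<in> \<B>1 \<Longrightarrow> \<not> (\<delta> (fst ` P) (fst ` Q) \<and> \<alpha> (snd ` P) (snd ` Q))"
    by (rule not_product_proximityE[OF far(1)]) blast
  obtain \<A>2 \<B>2 where 2: "finite \<A>2" "finite \<B>2" "A = \<Union>\<A>2" "B2 = \<Union>\<B>2"
      "\<And>P Q. P \<in> \<A>2 \<Longrightarrow> Q \<in> \<B>2 \<Longrightarrow> \<not> (\<delta> (fst ` P) (fst ` Q) \<and> \<alpha> (snd ` P) (snd ` Q))"
    by (rule not_product_proximityE[OF far(2)]) blast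
  \<comment> \<open>A common refinement of the two covers of \<open>A\<close> works against both parts.\<close>
  let ?\<A> = "(\<lambda>(P1, P2). P1 \<inter> P2) ` (\<A>1 \<times> \<A>2)"
  have "\<Union>?\<A> = \<Union>\<A>1 \<inter> \<Union>\<A>2"
    by auto
  then have A: "A = \<Union>?\<A>"
    unfolding 1(3)[symmetric] 2(3)[symmetric] by simp
  have B: "B1 \<union> B2 = \<Union>(\<B>1 \<union> \<B>2)"
    unfolding 1(4) 2(4) by (rule Union_Un_distrib[symmetric])
  obtain R Q where "R \<in> ?\<A>" "Q \<in> \<B>1 \<union> \<B>2" "\<delta> (fst ` R) (fst ` Q)" "\<alpha> (snd ` R) (snd ` Q)"
    by (rule product_proximityE[OF near _ _ A B]) (use 1(1,2) 2(1,2) in auto)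
  then obtain P1 P2 where PQ: "P1 \<in> \<A>1" "P2 \<in> \<A>2" "Q \<in> \<B>1 \<union> \<B>2"
    "\<delta> (fst ` (P1 \<inter> P2)) (fst ` Q)" "\<alpha> (snd ` (P1 \<inter> P2)) (snd ` Q)"
    by auto
  have Q: "Q \<subseteq> X \<times> Z"
    using PQ(3) sub(2,3) unfolding 1(4) 2(4) by blast
  have up: "\<delta> (fst ` P) (fst ` Q) \<and> \<alpha> (snd ` P) (snd ` Q)" if "P1 \<inter> P2 \<subseteq> P" "P \<subseteq> A" for P
  proof -
    have "P \<subseteq> X \<times> Z"
      using that sub(1) by blast
    then have "fst ` P \<subseteq> X" "fst ` Q \<subseteq> X" "snd ` P \<subseteq> Z" "snd ` Q \<subseteq> Z"
      using Q by auto
    then show ?thesis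
      using sym_mono_on_mono[OF sm(1) PQ(4) image_mono[OF that(1)] subset_refl]
        sym_mono_on_mono[OF sm(2) PQ(5) image_mono[OF that(1)] subset_refl]
      by simp
  qed
  have "P1 \<subseteq> A" "P2 \<subseteq> A"
    using Union_upper[OF PQ(1)] Union_upper[OF PQ(2)] 1(3) 2(3) by simp_all
  then show False
    using up[OF Int_lower1] up[OF Int_lower2] 1(5)[OF PQ(1)] 2(5)[OF PQ(2)] PQ(3) by blast
qed

lemma product_proximity_Un_left:
  assumes sm: "sym_mono_on X \<delta>" "sym_mono_on Z \<alpha>"
    and sub: "A1 \<subseteq> X \<times> Z" "A2 \<subseteq> X \<times> Z" "B \<subseteq> X \<times> Z"
    and near: "product_proximity \<delta> \<alpha> (A1 \<union> A2) B"
  shows "product_proximity \<delta> \<alpha> A1 B \<or> product_proximity \<delta> \<alpha> A2 B"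
proof -
  have "product_proximity \<delta> \<alpha> B (A1 \<union> A2)"
    using product_proximity_sym[OF sm _ _ near] sub by blast
  then have "product_proximity \<delta> \<alpha> B A1 \<or> product_proximity \<delta> \<alpha> B A2"
    by (rule product_proximity_Un_right[OF sm sub(3,1,2)])
  then show ?thesis
    using product_proximity_sym[OF sm] sub by blast
qed

section \<open>Gluing along a level of the interval\<close>

lemma pc_map_image_subset:
  assumes "pc_map X \<delta> Y \<delta>' f" "E \<subseteq> X"
  shows "f ` E \<subseteq> Y"
  using assms unfolding pc_map_def by blast

lemma pc_map_near:
  assumes "pc_map X \<delta> Y \<delta>' f" "E \<subseteq> X" "F \<subseteq> X" "\<delta> E F"
  shows "\<delta>' (f ` E) (f ` F)"
  using assms unfolding pc_map_def by blast

lemma product_proximity_level_right: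
  assumes near: "product_proximity d unit_interval_proximity A B"
    and A: "A \<subseteq> V \<times> {0..c}" and B: "B \<subseteq> V \<times> {c..1}"
  shows "product_proximity d unit_interval_proximity A ((\<lambda>b. (fst b, c)) ` B)"
proof -
  let ?p = "\<lambda>b :: 'a \<times> real. (fst b, c)"
  have "product_proximity d unit_interval_proximity (id ` A) (?p ` B)"
  proof (rule product_proximity_image[OF near])
    fix P Q
    assume PQ: "P \<subseteq> A" "Q \<subseteq> B" "d (fst ` P) (fst ` Q)"
      and I: "unit_interval_proximity (snd ` P) (snd ` Q)"
    have "Q \<noteq> {}"
      using I zero_less_one unfolding unit_interval_proximity_iff by blast
    then have "snd ` ?p ` Q = {c}" "fst ` ?p ` Q = fst ` Q"
      by (auto simp: image_image)
    moreover have "snd ` P \<subseteq> {0..c}" "snd ` Q \<subseteq> {c..1}"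
      using snd_image_subset[OF subset_trans[OF PQ(1) A]] snd_image_subset[OF subset_trans[OF PQ(2) B]]
      by blast+
    then have "unit_interval_proximity (snd ` P) {c}"
      by (rule unit_interval_proximity_singleton_between(1)[OF I])
    ultimately show "d (fst ` id ` P) (fst ` ?p ` Q) \<and>
        unit_interval_proximity (snd ` id ` P) (snd ` ?p ` Q)"
      using PQ(3) by simp
  qed
  then show ?thesis by simp
qed

text \<open>
  A set above the level \<open>c\<close> that is near some set below it is near its own projection to the level,
  because every finite cover of it has a member that approaches the level.
\<close>

lemma product_proximity_level_self:
  assumes d: "proximity_on V d"
    and near: "product_proximity d unit_interval_proximity A B"
    and A: "A \<subseteq> V \<times> {0..c}" and B: "B \<subseteq> V \<times> {c..1}"
  shows "product_proximity d unit_interval_proximity ((\<lambda>b. (fst b, c)) ` B) B"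
  unfolding product_proximity_def
proof (intro allI impI)
  let ?p = "\<lambda>b :: 'a \<times> real. (fst b, c)"
  fix \<P> \<Q>
  assume fin: "finite \<P>" "finite \<Q>" and P: "?p ` B = \<Union>\<P>" and Q: "B = \<Union>\<Q>"
  \<comment> \<open>The two covers are refined to a single cover of \<open>B\<close>, to which the nearness of \<open>A\<close> and \<open>B\<close>
    applies; the member it yields is a nonempty set approaching the level \<open>c\<close>.\<close>
  let ?\<B> = "(\<lambda>(P, Q). Q \<inter> ?p -` P) ` (\<P> \<times> \<Q>)"
  have cover: "B = \<Union>?\<B>"
  proof
    show "B \<subseteq> \<Union>?\<B>"
    proof
      fix b
      assume b: "b \<in> B"
      then have "?p b \<in> \<Union>\<P>"
        unfolding P[symmetric] by (rule imageI)
      then obtain P where "P \<in> \<P>" "?p b \<in> P"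
        by blast
      moreover obtain Q where "Q \<in> \<Q>" "b \<in> Q"
        using b unfolding Q by blast
      ultimately show "b \<in> \<Union>?\<B>" by force
    qed
    show "\<Union>?\<B> \<subseteq> B"
      unfolding Q by auto
  qed
  have "finite ?\<B>" "finite {A}" "A = \<Union>{A}"
    using fin by auto
  then obtain R S where "R \<in> {A}" "S \<in> ?\<B>" "unit_interval_proximity (snd ` R) (snd ` S)"
    using product_proximityE[OF near _ _ _ cover] by metis
  then obtain P0 Q0 where PQ: "P0 \<in> \<P>" "Q0 \<in> \<Q>"
    and I: "unit_interval_proximity (snd ` A) (snd ` (Q0 \<inter> ?p -` P0))"
    by auto
  let ?S = "Q0 \<inter> ?p -` P0"
  have SB: "?S \<subseteq> B" "Q0 \<subseteq> B"
    unfolding Q using PQ by blast+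
  have P0: "P0 \<subseteq> ?p ` B"
    unfolding P using PQ by blast
  have "?S \<noteq> {}"
    using I zero_less_one unfolding unit_interval_proximity_iff by blast
  then obtain b where b: "b \<in> Q0" "?p b \<in> P0"
    by blast
  have "c \<in> {0..1}"
  proof -
    obtain a where "a \<in> A"
      using I zero_less_one unfolding unit_interval_proximity_iff by blast
    then have "a \<in> V \<times> {0..c}" "b \<in> V \<times> {c..1}"
      using A B b(1) SB(2) by blast+
    then show ?thesis by auto
  qed
  have Q0_sub: "Q0 \<subseteq> V \<times> {c..1}"
    using SB(2) B by (rule subset_trans)
  have "?p ` B \<subseteq> V \<times> {c}"
    using fst_image_subset[OF B] by auto
  with P0 have P0_sub: "P0 \<subseteq> V \<times> {c}"
    by (rule subset_trans)
  have "fst ` P0 \<subseteq> V" "fst ` Q0 \<subseteq> V"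
    using fst_image_subset[OF P0_sub] fst_image_subset[OF Q0_sub] .
  moreover have "fst b \<in> fst ` P0 \<inter> fst ` Q0"
    using imageI[OF b(1), of fst] imageI[OF b(2), of fst] by simp
  ultimately have 1: "d (fst ` P0) (fst ` Q0)"
    using proximity_on_Int_near[OF d, of "fst ` P0" "fst ` Q0"] by blast
  have "snd ` A \<subseteq> {0..c}" "snd ` ?S \<subseteq> {c..1}"
    using snd_image_subset[OF A] snd_image_subset[OF subset_trans[OF SB(1) B]] .
  then have "unit_interval_proximity {c} (snd ` ?S)"
    by (rule unit_interval_proximity_singleton_between(2)[OF I])
  moreover have "{c} \<subseteq> snd ` P0" "snd ` ?S \<subseteq> snd ` Q0"
    using imageI[OF b(2), of snd] by auto
  moreover have "{c} \<subseteq> {0..1}" "{c..1} \<subseteq> {0..1}"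
    using \<open>c \<in> {0..1}\<close> by auto
  then have "snd ` P0 \<subseteq> {0..1}" "snd ` Q0 \<subseteq> {0..1}"
    using snd_image_subset[OF P0_sub] snd_image_subset[OF Q0_sub] by (meson subset_trans)+
  ultimately have "unit_interval_proximity (snd ` P0) (snd ` Q0)"
    by (rule sym_mono_on_mono[OF sym_mono_on_unit_interval])
  with 1 PQ show "\<exists>P\<in>\<P>. \<exists>Q\<in>\<Q>. d (fst ` P) (fst ` Q) \<and> unit_interval_proximity (snd ` P) (snd ` Q)"
    by blast
qed

text \<open>
  The case of gluing in which the two near sets lie on different sides of the level \<open>c\<close>.
\<close>

lemma pc_map_glue_cross:
  assumes d: "proximity_on V d" and Y: "proximity_on Y \<delta>'" and c: "c \<in> {0..1}"
    and lo: "pc_map (V \<times> {0..c}) (product_proximity d unit_interval_proximity) Y \<delta>' G"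
    and hi: "pc_map (V \<times> {c..1}) (product_proximity d unit_interval_proximity) Y \<delta>' G"
    and A: "A \<subseteq> V \<times> {0..c}" and B: "B \<subseteq> V \<times> {c..1}"
    and near: "product_proximity d unit_interval_proximity A B"
  shows "\<delta>' (G ` A) (G ` B)"
proof (rule ccontr)
  let ?p = "\<lambda>b :: 'a \<times> real. (fst b, c)"
  let ?N = "product_proximity d unit_interval_proximity"
  assume far: "\<not> \<delta>' (G ` A) (G ` B)"
  have GA: "G ` A \<subseteq> Y" and GB: "G ` B \<subseteq> Y"
    using pc_map_image_subset[OF lo A] pc_map_image_subset[OF hi B] .
  obtain C where C: "C \<subseteq> Y" "\<not> \<delta>' (G ` A) C" "\<not> \<delta>' (Y - C) (G ` B)"
    using proximity_on_separation[OF Y GA GB far] .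
  note smY = proximity_on_imp_sym_mono_on[OF Y]
  define B1 where "B1 = {b \<in> B. G (?p b) \<in> C}"
  define B2 where "B2 = {b \<in> B. G (?p b) \<notin> C}"
  have B12: "B = B1 \<union> B2" "B1 \<subseteq> V \<times> {c..1}" "B2 \<subseteq> V \<times> {c..1}"
    using B unfolding B1_def B2_def by auto
  have "V \<times> {0..c} \<subseteq> V \<times> {0..1}" "V \<times> {c..1} \<subseteq> V \<times> {0..1}"
    using c by auto
  then have "A \<subseteq> V \<times> {0..1}" "B1 \<subseteq> V \<times> {0..1}" "B2 \<subseteq> V \<times> {0..1}"
    using A B12(2,3) by (meson subset_trans)+
  then have "?N A B1 \<or> ?N A B2"
    by (rule product_proximity_Un_right[OF proximity_on_imp_sym_mono_on[OF d] sym_mono_on_unit_interval])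
      (use near B12(1) in simp)
  then consider "?N A B1" | "?N A B2"
    by blast
  then show False
  proof cases
    case 1
    have "?p ` B1 \<subseteq> V \<times> {0..c}"
      using B12(2) c by auto
    then have "\<delta>' (G ` A) (G ` ?p ` B1)"
      by (rule pc_map_near[OF lo A _ product_proximity_level_right[OF 1 A B12(2)]])
    moreover have "G ` ?p ` B1 \<subseteq> C"
      unfolding B1_def by auto
    ultimately show False
      using sym_mono_on_mono[OF smY _ subset_refl _ GA C(1)] C(2) by blast
  next
    case 2
    have p: "?p ` B2 \<subseteq> V \<times> {c..1}"
      using B12(3) c by auto
    then have "\<delta>' (G ` ?p ` B2) (G ` B2)"
      by (rule pc_map_near[OF hi _ B12(3) product_proximity_level_self[OF d 2 A B12(3)]])
    moreover have "G ` ?p ` B2 \<subseteq> Y"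
      using pc_map_image_subset[OF hi p] .
    then have "G ` ?p ` B2 \<subseteq> Y - C"
      unfolding B2_def by auto
    moreover have "G ` B2 \<subseteq> G ` B"
      using B12(1) by blast
    ultimately show False
      using sym_mono_on_mono[OF smY _ _ _ Diff_subset GB] C(3) by blast
  qed
qed

lemma pc_map_glue:
  assumes d: "proximity_on V d" and Y: "proximity_on Y \<delta>'" and c: "c \<in> {0..1}"
    and lo: "pc_map (V \<times> {0..c}) (product_proximity d unit_interval_proximity) Y \<delta>' G"
    and hi: "pc_map (V \<times> {c..1}) (product_proximity d unit_interval_proximity) Y \<delta>' G"
  shows "pc_map (V \<times> {0..1}) (product_proximity d unit_interval_proximity) Y \<delta>' G"
proof -
  let ?N = "product_proximity d unit_interval_proximity"
  let ?L = "V \<times> {0..c}" and ?H = "V \<times> {c..1}"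
  note smd = proximity_on_imp_sym_mono_on[OF d] and smI = sym_mono_on_unit_interval
  note smY = proximity_on_imp_sym_mono_on[OF Y]
  have LH: "V \<times> {0..1} = ?L \<union> ?H"
    using c by auto
  have img: "G ` (V \<times> {0..1}) \<subseteq> Y"
    using pc_map_image_subset[OF lo subset_refl] pc_map_image_subset[OF hi subset_refl]
    unfolding LH by (simp add: image_Un)
  have "\<delta>' (G ` A) (G ` B)" if A: "A \<subseteq> V \<times> {0..1}" and B: "B \<subseteq> V \<times> {0..1}" and N: "?N A B" for A B
  proof -
    have split: "S = S \<inter> ?L \<union> S \<inter> ?H" if "S \<subseteq> V \<times> {0..1}" for S
      using that LH by blast
    have I: "S \<inter> T \<subseteq> V \<times> {0..1}" if "S \<subseteq> V \<times> {0..1}" for S T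
      using that by blast
    have "?N (A \<inter> ?L) B \<or> ?N (A \<inter> ?H) B"
      by (rule product_proximity_Un_left[OF smd smI I[OF A] I[OF A] B])
        (use N split[OF A] in simp)
    then obtain A' where A': "?N A' B" "A' \<subseteq> A" "A' \<subseteq> ?L \<or> A' \<subseteq> ?H"
      using Int_lower1 Int_lower2 by metis
    have "?N A' (B \<inter> ?L) \<or> ?N A' (B \<inter> ?H)"
      by (rule product_proximity_Un_right[OF smd smI subset_trans[OF A'(2) A] I[OF B] I[OF B]])
        (use A'(1) split[OF B] in simp)
    then obtain B' where B': "?N A' B'" "B' \<subseteq> B" "B' \<subseteq> ?L \<or> B' \<subseteq> ?H"
      using Int_lower1 Int_lower2 by metis
    have AB': "A' \<subseteq> V \<times> {0..1}" "B' \<subseteq> V \<times> {0..1}"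
      using A B A'(2) B'(2) by blast+
    have "?N B' A'"
      using product_proximity_sym[OF smd smI AB' B'(1)] .
    have GAB': "G ` A' \<subseteq> Y" "G ` B' \<subseteq> Y"
      using AB' img by blast+
    consider "A' \<subseteq> ?L" "B' \<subseteq> ?L" | "A' \<subseteq> ?H" "B' \<subseteq> ?H" | "A' \<subseteq> ?L" "B' \<subseteq> ?H" | "B' \<subseteq> ?L" "A' \<subseteq> ?H"
      using A'(3) B'(3) by blast
    then have "\<delta>' (G ` A') (G ` B')"
    proof cases
      case 1
      then show ?thesis by (rule pc_map_near[OF lo _ _ B'(1)])
    next
      case 2
      then show ?thesis by (rule pc_map_near[OF hi _ _ B'(1)])
    next
      case 3
      then show ?thesis by (rule pc_map_glue_cross[OF d Y c lo hi _ _ B'(1)])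
    next
      case 4
      then have "\<delta>' (G ` B') (G ` A')"
        by (rule pc_map_glue_cross[OF d Y c lo hi _ _ \<open>?N B' A'\<close>])
      then show ?thesis
        by (rule sym_mono_on_sym[OF smY _ GAB'(2,1)])
    qed
    moreover have "G ` A \<subseteq> Y" "G ` B \<subseteq> Y"
      using A B img by blast+
    ultimately show ?thesis
      by (rule sym_mono_on_mono[OF smY _ image_mono[OF A'(2)] image_mono[OF B'(2)]])
  qed
  with img show ?thesis
    unfolding pc_map_def by blast
qed

section \<open>Proximal homotopy\<close>

lemma pc_map_cong:
  assumes "pc_map X \<delta> Y \<delta>' f" and "\<And>x. x \<in> X \<Longrightarrow> f x = g x"
  shows "pc_map X \<delta> Y \<delta>' g"
proof -
  have "f ` E = g ` E" if "E \<subseteq> X" for E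
    using assms(2) that by (intro image_cong) auto
  then show ?thesis
    using assms(1) unfolding pc_map_def by auto
qed

lemma pc_map_reparametrize:
  assumes H: "pc_map (V \<times> {0..1}) (product_proximity d unit_interval_proximity) Y \<delta>' H"
    and \<phi>: "\<phi> ` J \<subseteq> {0..1}" and "L > 0" and L: "\<And>s t. \<bar>\<phi> s - \<phi> t\<bar> \<le> L * \<bar>s - t\<bar>"
  shows "pc_map (V \<times> J) (product_proximity d unit_interval_proximity) Y \<delta>' (\<lambda>z. H (fst z, \<phi> (snd z)))"
proof -
  let ?N = "product_proximity d unit_interval_proximity"
  let ?\<Phi> = "\<lambda>z :: 'a \<times> real. (fst z, \<phi> (snd z))"
  have \<Phi>: "?\<Phi> ` A \<subseteq> V \<times> {0..1}" if "A \<subseteq> V \<times> J" for A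
  proof -
    have "\<phi> ` snd ` A \<subseteq> {0..1}"
      using image_mono[OF snd_image_subset[OF that], of \<phi>] \<phi> by (rule subset_trans)
    with fst_image_subset[OF that] show ?thesis by auto
  qed
  have "\<delta>' (H ` ?\<Phi> ` A) (H ` ?\<Phi> ` B)" if AB: "A \<subseteq> V \<times> J" "B \<subseteq> V \<times> J" and near: "?N A B" for A B
  proof -
    have "?N (?\<Phi> ` A) (?\<Phi> ` B)"
    proof (rule product_proximity_image[OF near])
      fix P Q
      assume PQ: "P \<subseteq> A" "Q \<subseteq> B" "d (fst ` P) (fst ` Q)"
        and I: "unit_interval_proximity (snd ` P) (snd ` Q)"
      have "\<phi> ` snd ` P \<subseteq> {0..1}" "\<phi> ` snd ` Q \<subseteq> {0..1}"
        using image_mono[OF snd_image_subset[OF subset_trans[OF PQ(1) AB(1)]], of \<phi>]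
          image_mono[OF snd_image_subset[OF subset_trans[OF PQ(2) AB(2)]], of \<phi>] \<phi>
        by (meson subset_trans)+
      then have "unit_interval_proximity (\<phi> ` snd ` P) (\<phi> ` snd ` Q)"
        by (rule unit_interval_proximity_Lipschitz_image[OF I _ _ \<open>L > 0\<close> L])
      with PQ(3) show "d (fst ` ?\<Phi> ` P) (fst ` ?\<Phi> ` Q) \<and>
          unit_interval_proximity (snd ` ?\<Phi> ` P) (snd ` ?\<Phi> ` Q)"
        by (simp add: image_image)
    qed
    then show ?thesis
      by (rule pc_map_near[OF H \<Phi>[OF AB(1)] \<Phi>[OF AB(2)]])
  qed
  moreover have "H ` ?\<Phi> ` (V \<times> J) \<subseteq> Y"
    using pc_map_image_subset[OF H \<Phi>[OF subset_refl]] .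
  ultimately show ?thesis
    unfolding pc_map_def by (simp add: image_image)
qed

text \<open>
  Restriction to a subset and refinement of the source proximity in one statement.
\<close>

lemma proximally_homotopic_weaken:
  assumes "proximally_homotopic X \<delta> Y \<delta>' f g" and V: "V \<subseteq> X"
    and le: "\<And>E F. E \<subseteq> V \<Longrightarrow> F \<subseteq> V \<Longrightarrow> d E F \<Longrightarrow> \<delta> E F"
  shows "proximally_homotopic V d Y \<delta>' f g"
proof -
  obtain H where H: "pc_map (X \<times> {0..1}) (product_proximity \<delta> unit_interval_proximity) Y \<delta>' H"
    and ends: "\<forall>x\<in>X. H (x, 0) = f x \<and> H (x, 1) = g x"
    using assms(1) unfolding proximally_homotopic_def by blast
  have sub: "V \<times> {0..1} \<subseteq> X \<times> {0..1::real}"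
    using V by blast
  have le_prod: "product_proximity \<delta> unit_interval_proximity A B"
    if AB: "A \<subseteq> V \<times> {0..1}" "B \<subseteq> V \<times> {0..1}"
      and near: "product_proximity d unit_interval_proximity A B" for A B
  proof -
    have "product_proximity \<delta> unit_interval_proximity (id ` A) (id ` B)"
    proof (rule product_proximity_image[OF near])
      fix P Q
      assume PQ: "P \<subseteq> A" "Q \<subseteq> B" "d (fst ` P) (fst ` Q)"
        "unit_interval_proximity (snd ` P) (snd ` Q)"
      have "fst ` P \<subseteq> V" "fst ` Q \<subseteq> V"
        using fst_image_subset[OF subset_trans[OF PQ(1) AB(1)]]
          fst_image_subset[OF subset_trans[OF PQ(2) AB(2)]] .
      with le PQ(3,4) show "\<delta> (fst ` id ` P) (fst ` id ` Q) \<and>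
          unit_interval_proximity (snd ` id ` P) (snd ` id ` Q)"
        by simp
    qed
    then show ?thesis by simp
  qed
  have "pc_map (V \<times> {0..1}) (product_proximity d unit_interval_proximity) Y \<delta>' H"
    unfolding pc_map_def
  proof (intro conjI allI impI)
    show "H ` (V \<times> {0..1}) \<subseteq> Y"
      using pc_map_image_subset[OF H sub] .
    fix A B :: "('a \<times> real) set"
    assume AB: "A \<subseteq> V \<times> {0..1}" "B \<subseteq> V \<times> {0..1}"
      and "product_proximity d unit_interval_proximity A B"
    then have "product_proximity \<delta> unit_interval_proximity A B"
      by (rule le_prod)
    then show "\<delta>' (H ` A) (H ` B)"
      by (rule pc_map_near[OF H subset_trans[OF AB(1) sub] subset_trans[OF AB(2) sub]])
  qed
  with ends V show ?thesis
    unfolding proximally_homotopic_def by blast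
qed

lemma proximally_homotopic_sym:
  assumes "proximally_homotopic V d Y \<delta>' f g"
  shows "proximally_homotopic V d Y \<delta>' g f"
proof -
  obtain H where H: "pc_map (V \<times> {0..1}) (product_proximity d unit_interval_proximity) Y \<delta>' H"
    and ends: "\<forall>x\<in>V. H (x, 0) = f x \<and> H (x, 1) = g x"
    using assms unfolding proximally_homotopic_def by blast
  have "pc_map (V \<times> {0..1}) (product_proximity d unit_interval_proximity) Y \<delta>'
      (\<lambda>z. H (fst z, 1 - snd z))"
    by (rule pc_map_reparametrize[OF H, where L = 1]) auto
  with ends show ?thesis
    unfolding proximally_homotopic_def by (intro exI[of _ "\<lambda>z. H (fst z, 1 - snd z)"]) simp
qed

lemma proximally_homotopic_trans:
  assumes d: "proximity_on V d" and Y: "proximity_on Y \<delta>'"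
    and "proximally_homotopic V d Y \<delta>' f g" and "proximally_homotopic V d Y \<delta>' g h"
  shows "proximally_homotopic V d Y \<delta>' f h"
proof -
  let ?N = "product_proximity d unit_interval_proximity"
  obtain H where H: "pc_map (V \<times> {0..1}) ?N Y \<delta>' H"
    and H_ends: "\<And>x. x \<in> V \<Longrightarrow> H (x, 0) = f x \<and> H (x, 1) = g x"
    using assms(3) unfolding proximally_homotopic_def by blast
  obtain K where K: "pc_map (V \<times> {0..1}) ?N Y \<delta>' K"
    and K_ends: "\<And>x. x \<in> V \<Longrightarrow> K (x, 0) = g x \<and> K (x, 1) = h x"
    using assms(4) unfolding proximally_homotopic_def by blast
  define G where "G = (\<lambda>z :: 'a \<times> real.
    if snd z \<le> 1/2 then H (fst z, 2 * snd z) else K (fst z, 2 * snd z - 1))"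
  have "pc_map (V \<times> {0..1/2}) ?N Y \<delta>' (\<lambda>z. H (fst z, 2 * snd z))"
    by (rule pc_map_reparametrize[OF H, where L = 2]) (auto simp: abs_if)
  then have lo: "pc_map (V \<times> {0..1/2}) ?N Y \<delta>' G"
    by (rule pc_map_cong) (auto simp: G_def)
  have "pc_map (V \<times> {1/2..1}) ?N Y \<delta>' (\<lambda>z. K (fst z, 2 * snd z - 1))"
    by (rule pc_map_reparametrize[OF K, where L = 2]) (auto simp: abs_if)
  then have hi: "pc_map (V \<times> {1/2..1}) ?N Y \<delta>' G"
  proof (rule pc_map_cong)
    fix z :: "'a \<times> real"
    assume z: "z \<in> V \<times> {1/2..1}"
    show "K (fst z, 2 * snd z - 1) = G z"
    proof (cases "snd z = 1/2")
      case True
      then have t: "2 * snd z = 1" by simp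
      have "fst z \<in> V"
        using z by auto
      with H_ends[of "fst z"] K_ends[of "fst z"] True show ?thesis
        by (simp add: G_def t)
    next
      case False
      with z show ?thesis
        by (auto simp: G_def)
    qed
  qed
  have "pc_map (V \<times> {0..1}) ?N Y \<delta>' G"
    by (rule pc_map_glue[OF d Y _ lo hi]) simp
  moreover have "\<forall>x\<in>V. G (x, 0) = f x \<and> G (x, 1) = h x"
    using H_ends K_ends by (simp add: G_def)
  ultimately show ?thesis
    unfolding proximally_homotopic_def by blast
qed

section \<open>Monotonicity of the proximal homotopic distance\<close>

text \<open>
  It suffices to compare the two homotopy relations on each subset, since then each cover admissible
  for one distance is admissible for the other.
\<close>

lemma proximal_homotopic_distance_mono:
  fixes X :: "'a set"
  assumes transfer: "\<And>V. V \<subseteq> X \<Longrightarrow> proximally_homotopic V (subspace_proximity V \<delta>) Y \<delta>' f g \<Longrightarrow>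
      proximally_homotopic V (subspace_proximity V d) Z d' f' g'"
  shows "proximal_homotopic_distance X d Z d' f' g' \<le> proximal_homotopic_distance X \<delta> Y \<delta>' f g"
  unfolding proximal_homotopic_distance_def
proof (rule Inf_superset_mono, rule subsetI)
  fix n
  assume "n \<in> {enat m | m. m > 0 \<and> (\<exists>V :: nat \<Rightarrow> 'a set. (\<Union>j\<in>{1..m}. V j) = X \<and>
    (\<forall>j\<in>{1..m}. proximally_homotopic (V j) (subspace_proximity (V j) \<delta>) Y \<delta>' f g))}"
  then obtain m and V :: "nat \<Rightarrow> 'a set" where n: "n = enat m" and m: "m > 0"
    and V: "(\<Union>j\<in>{1..m}. V j) = X"
    and hom: "\<forall>j\<in>{1..m}. proximally_homotopic (V j) (subspace_proximity (V j) \<delta>) Y \<delta>' f g"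
    by (elim CollectE exE conjE)
  have "\<forall>j\<in>{1..m}. proximally_homotopic (V j) (subspace_proximity (V j) d) Z d' f' g'"
  proof
    fix j
    assume j: "j \<in> {1..m}"
    then have "V j \<subseteq> (\<Union>j\<in>{1..m}. V j)"
      by (rule UN_upper)
    then have "V j \<subseteq> X"
      unfolding V .
    then show "proximally_homotopic (V j) (subspace_proximity (V j) d) Z d' f' g'"
      using bspec[OF hom j] by (rule transfer)
  qed
  then show "n \<in> {enat m | m. m > 0 \<and> (\<exists>V :: nat \<Rightarrow> 'a set. (\<Union>j\<in>{1..m}. V j) = X \<and>
    (\<forall>j\<in>{1..m}. proximally_homotopic (V j) (subspace_proximity (V j) d) Z d' f' g'))}"
    using n m V by (intro CollectI exI[of _ m] exI[of _ V] conjI)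
qed

theorem theorem4p6:
  fixes X :: "'a set" and Y :: "'b set"
    and \<delta>1 \<delta>1' :: "'a set \<Rightarrow> 'a set \<Rightarrow> bool" and \<delta>' :: "'b set \<Rightarrow> 'b set \<Rightarrow> bool"
    and f1 f2 g1 g2 :: "'a \<Rightarrow> 'b"
  assumes "proximity_on X \<delta>1" and "proximity_on X \<delta>1'" and "proximity_on Y \<delta>'"
    and "pc_map X \<delta>1 Y \<delta>' f1" and "pc_map X \<delta>1 Y \<delta>' f2"
    and "pc_map X \<delta>1' Y \<delta>' g1" and "pc_map X \<delta>1' Y \<delta>' g2"
    and "proximally_homotopic X \<delta>1 Y \<delta>' f1 f2"
    and "proximally_homotopic X \<delta>1' Y \<delta>' g1 g2"
    and "finer_proximity X \<delta>1' \<delta>1"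
  shows "proximal_homotopic_distance X \<delta>1' Y \<delta>' f2 g2
       \<le> proximal_homotopic_distance X \<delta>1 Y \<delta>' f1 g1"
proof (rule proximal_homotopic_distance_mono)
  fix V
  assume V: "V \<subseteq> X" and fg: "proximally_homotopic V (subspace_proximity V \<delta>1) Y \<delta>' f1 g1"
  let ?d = "subspace_proximity V \<delta>1'"
  have finer: "\<delta>1 E F" if "E \<subseteq> V" "F \<subseteq> V" "?d E F" for E F
    using assms(10)[unfolded finer_proximity_def, rule_format,
        OF subset_trans[OF that(1) V] subset_trans[OF that(2) V]] that(3)
    by (simp add: subspace_proximity_def)
  have d: "proximity_on V ?d"
    using proximity_on_subspace[OF assms(2) V] .
  have "proximally_homotopic V ?d Y \<delta>' f1 f2"
    by (rule proximally_homotopic_weaken[OF assms(8) V finer])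
  then have "proximally_homotopic V ?d Y \<delta>' f2 f1"
    by (rule proximally_homotopic_sym)
  moreover have "proximally_homotopic V ?d Y \<delta>' f1 g1"
    by (rule proximally_homotopic_weaken[OF fg subset_refl])
      (simp add: subspace_proximity_def finer)
  moreover have "proximally_homotopic V ?d Y \<delta>' g1 g2"
    by (rule proximally_homotopic_weaken[OF assms(9) V]) (simp add: subspace_proximity_def)
  ultimately show "proximally_homotopic V ?d Y \<delta>' f2 g2"
    using proximally_homotopic_trans[OF d assms(3)] by blast
qed

end
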